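(* Let $(X,d)$ be a quasi-convex, complete and separable metric space and let $m$ be a Borel probability measure on $X$. Then the set $$\{ f \in D^{\infty}(X) : m(S(f)) = 0 \}$$ is residual, and therefore dense, in the Banach space $D^{\infty}(X)$ endowed with the norm $\|f\|_{D^\infty(X)} = \|f\|_\infty + \|\mathrm{Lip}\, f\|_\infty$.
   Context: A metric space $(X,d)$ is quasi-convex if there exists a constant $C \ge 1$ such that every pair of points $x,y\in X$ can be joined by a curve $\gamma$ with length $l(\gamma) \le C\, d(x,y)$, where for a curve $\gamma:[a,b]\to X$ the length is $l(\gamma) = \sup \sum_{i=1}^n d(\gamma(t_i),\gamma(t_{i+1}))$, the supremum being over all $n\in\mathbb{N}$ and all $a=t_1<\dots<t_{n+1}=b$. For $f:X\to\mathbb{R}$ the point-wise Lipschitz constant is $$\mathrm{Lip}\, f(x) := \limsup_{y\to x,\, y\neq x} \frac{|f(x)-f(y)|}{d(x,y)},$$ and the singular set of $f$ is $S(f) := \{x\in X : \mathrm{Lip}\, f(x) = 0\}$. $\|\cdot\|_\infty$ denotes the uniform (supremum) norm over $X$, and $$D^\infty(X) := \{ f:X\to\mathbb{R} : \|f\|_\infty + \|\mathrm{Lip}\, f\|_\infty < \infty\}.$$ When $X$ is quasi-convex, $D^\infty(X)$ coincides with the space of bounded Lipschitz functions on $X$ and is a Banach space with the norm $\|f\|_{D^\infty(X)} := \|f\|_\infty + \|\mathrm{Lip}\, f\|_\infty$. For $f \in D^\infty(X)$ the function $\mathrm{Lip}\, f$ is universally measurable, so $m(S(f))$ is meaningful,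 with $m$ extended to its completion. A subset of a topological space is residual if it contains a countable intersection of open dense sets. *)

theory Defs
  imports "HOL-Probability.Probability"
begin

definition curve_length :: "real \<Rightarrow> real \<Rightarrow> (real \<Rightarrow> 'a::metric_space) \<Rightarrow> ereal" where
  "curve_length a b \<gamma> =
     (SUP (n, t) \<in> {(n::nat, t::nat \<Rightarrow> real). t 1 = a \<and> t (n + 1) = b \<and> (\<forall>i\<in>{1..n}. t i < t (i + 1))}.
        ereal (\<Sum>i = 1..n. dist (\<gamma> (t i)) (\<gamma> (t (i + 1)))))"

definition quasi_convex :: "'a::metric_space set \<Rightarrow> bool" where
  "quasi_convex X \<longleftrightarrow>
     (\<exists>C::real. C \<ge> 1 \<and> (\<forall>x\<in>X. \<forall>y\<in>X. \<exists>a b \<gamma>. a < b \<and> continuous_on {a..b} \<gamma> \<and> \<gamma> ` {a..b} \<subseteq> X \<and>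
        \<gamma> a = x \<and> \<gamma> b = y \<and> curve_length a b \<gamma> \<le> ereal (C * dist x y)))"

text \<open>The filter \<^term>\<open>at x\<close> excludes \<^term>\<open>x\<close> itself. At an isolated point the limit superior is
  \<^term>\<open>- \<infinity> :: ereal\<close>; a quasi-convex space with at least two points has no isolated points, and
  there the value is nonnegative. For a one-point space, where the limit superior is over the empty
  set, the space \<open>D_inf\<close> below is therefore empty.\<close>

definition Lip :: "('a::metric_space \<Rightarrow> real) \<Rightarrow> 'a \<Rightarrow> ereal" where
  "Lip f x = Limsup (at x) (\<lambda>y. ereal (\<bar>f x - f y\<bar> / dist x y))"

definition singular_set :: "('a::metric_space \<Rightarrow> real) \<Rightarrow> 'a set" where
  "singular_set f = {x. Lip f x = 0}"

definition uniform_norm :: "('a \<Rightarrow> ereal) \<Rightarrow> ereal" where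
  "uniform_norm g = (SUP x. \<bar>g x\<bar>)"

definition D_inf :: "('a::metric_space \<Rightarrow> real) set" where
  "D_inf = {f. uniform_norm (\<lambda>x. ereal (f x)) + uniform_norm (Lip f) < \<infinity>}"

definition D_inf_norm :: "('a::metric_space \<Rightarrow> real) \<Rightarrow> real" where
  "D_inf_norm f = real_of_ereal (uniform_norm (\<lambda>x. ereal (f x)) + uniform_norm (Lip f))"

definition D_inf_dist :: "('a::metric_space \<Rightarrow> real) \<Rightarrow> ('a \<Rightarrow> real) \<Rightarrow> real" where
  "D_inf_dist f g = D_inf_norm (\<lambda>x. f x - g x)"

definition D_inf_topology :: "('a::metric_space \<Rightarrow> real) topology" where
  "D_inf_topology = Metric_space.mtopology D_inf D_inf_dist"

definition dense_in :: "'b topology \<Rightarrow> 'b set \<Rightarrow> bool" where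
  "dense_in T A \<longleftrightarrow> A \<subseteq> topspace T \<and> T closure_of A = topspace T"

definition residual_in :: "'b topology \<Rightarrow> 'b set \<Rightarrow> bool" where
  "residual_in T A \<longleftrightarrow> A \<subseteq> topspace T \<and>
     (\<exists>\<U>. countable \<U> \<and> (\<forall>U\<in>\<U>. openin T U \<and> dense_in T U) \<and> topspace T \<inter> \<Inter>\<U> \<subseteq> A)"

text \<open>\<^const>\<open>D_inf_dist\<close> is a metric on \<^const>\<open>D_inf\<close>, so that \<^const>\<open>D_inf_topology\<close> is the
  norm topology.\<close>

lemma Lip_uminus: "Lip (\<lambda>x. - f x) = Lip f"
  by (auto simp: Lip_def fun_eq_iff abs_minus_commute)

lemma Lip_add: "Lip (\<lambda>x. f x + g x) x \<le> Lip f x + Lip g x"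
  if nb: "at x \<noteq> bot" and fin: "Lip f x < \<infinity>" "Lip g x < \<infinity>"
proof -
  have nn: "0 \<le> Lip h x" for h
    unfolding Lip_def by (rule le_Limsup[OF nb]) auto
  have "Lip (\<lambda>x. f x + g x) x \<le>
      Limsup (at x) (\<lambda>y. ereal (\<bar>f x - f y\<bar> / dist x y) + ereal (\<bar>g x - g y\<bar> / dist x y))"
    unfolding Lip_def
    by (rule Limsup_mono) (auto simp: add_divide_distrib[symmetric] intro!: divide_right_mono always_eventually)
  also have "\<dots> \<le> Lip f x + Lip g x"
  proof (rule ereal_le_epsilon2)
    fix e :: real assume e: "0 < e"
    obtain a b where ab: "Lip f x = ereal a" "Lip g x = ereal b"
      using fin nn[of f] nn[of g] by (cases "Lip f x"; cases "Lip g x") auto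
    have "\<forall>\<^sub>F y in at x. ereal (\<bar>f x - f y\<bar> / dist x y) < ereal (a + e/2)"
      by (rule Limsup_lessD) (use ab e in \<open>simp add: Lip_def\<close>)
    moreover have "\<forall>\<^sub>F y in at x. ereal (\<bar>g x - g y\<bar> / dist x y) < ereal (b + e/2)"
      by (rule Limsup_lessD) (use ab e in \<open>simp add: Lip_def\<close>)
    ultimately have "\<forall>\<^sub>F y in at x. ereal (\<bar>f x - f y\<bar> / dist x y) + ereal (\<bar>g x - g y\<bar> / dist x y)
        \<le> ereal (a + b + e)"
      by eventually_elim auto
    then show "Limsup (at x) (\<lambda>y. ereal (\<bar>f x - f y\<bar> / dist x y) + ereal (\<bar>g x - g y\<bar> / dist x y))
        \<le> Lip f x + Lip g x + ereal e"
      using ab by (intro Limsup_bounded) auto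
  qed
  finally show ?thesis .
qed

lemma uniform_norm_nonneg: "0 \<le> uniform_norm g"
  unfolding uniform_norm_def by (rule SUP_upper2[of undefined]) auto

lemma uniform_norm_upper: "\<bar>g x\<bar> \<le> uniform_norm g"
  unfolding uniform_norm_def by (rule SUP_upper) auto

lemma D_infD:
  fixes f :: "'a::metric_space \<Rightarrow> real"
  assumes "f \<in> D_inf"
  shows "uniform_norm (\<lambda>x. ereal (f x)) < \<infinity>" "uniform_norm (Lip f) < \<infinity>" "\<And>x. \<bar>Lip f x\<bar> < \<infinity>"
    "\<And>x :: 'a. at x \<noteq> bot" "\<And>x. 0 \<le> Lip f x"
proof -
  show 1: "uniform_norm (\<lambda>x. ereal (f x)) < \<infinity>" "uniform_norm (Lip f) < \<infinity>"
    using assms uniform_norm_nonneg[of "Lip f"] uniform_norm_nonneg[of "\<lambda>x. ereal (f x)"]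
    unfolding D_inf_def by auto
  then show 2: "\<bar>Lip f x\<bar> < \<infinity>" for x :: 'a
    using uniform_norm_upper[of "Lip f" x] by auto
  show 3: "at x \<noteq> bot" for x :: 'a
  proof
    assume "at x = bot"
    then have "Lip f x = - \<infinity>" by (simp add: Lip_def bot_ereal_def)
    with 2[of x] show False by auto
  qed
  show "0 \<le> Lip f x" for x :: 'a
    unfolding Lip_def by (rule le_Limsup[OF 3]) auto
qed

lemma uniform_norm_add:
  assumes "f \<in> D_inf" "g \<in> D_inf"
  shows "uniform_norm (\<lambda>x. ereal (f x + g x)) \<le> uniform_norm (\<lambda>x. ereal (f x)) + uniform_norm (\<lambda>x. ereal (g x))"
    "uniform_norm (Lip (\<lambda>x. f x + g x)) \<le> uniform_norm (Lip f) + uniform_norm (Lip g)"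
proof -
  have "\<bar>ereal (f x + g x)\<bar> \<le> uniform_norm (\<lambda>x. ereal (f x)) + uniform_norm (\<lambda>x. ereal (g x))" for x
  proof -
    have "\<bar>ereal (f x + g x)\<bar> \<le> \<bar>ereal (f x)\<bar> + \<bar>ereal (g x)\<bar>" by simp
    also have "\<dots> \<le> uniform_norm (\<lambda>x. ereal (f x)) + uniform_norm (\<lambda>x. ereal (g x))"
      by (intro add_mono uniform_norm_upper)
    finally show ?thesis .
  qed
  then show "uniform_norm (\<lambda>x. ereal (f x + g x)) \<le> uniform_norm (\<lambda>x. ereal (f x)) + uniform_norm (\<lambda>x. ereal (g x))"
    by (subst uniform_norm_def, intro SUP_least)
  have "\<bar>Lip (\<lambda>x. f x + g x) x\<bar> \<le> uniform_norm (Lip f) + uniform_norm (Lip g)" for x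
  proof -
    have "0 \<le> Lip (\<lambda>x. f x + g x) x"
      unfolding Lip_def by (rule le_Limsup[OF D_infD(4)[OF assms(1)]]) auto
    then have "\<bar>Lip (\<lambda>x. f x + g x) x\<bar> = Lip (\<lambda>x. f x + g x) x" by simp
    also have "\<dots> \<le> Lip f x + Lip g x"
      by (rule Lip_add) (use D_infD(3-5)[OF assms(1), of x] D_infD(3-5)[OF assms(2), of x] in auto)
    also have "\<dots> = \<bar>Lip f x\<bar> + \<bar>Lip g x\<bar>"
      using D_infD(5)[OF assms(1), of x] D_infD(5)[OF assms(2), of x] by simp
    also have "\<dots> \<le> uniform_norm (Lip f) + uniform_norm (Lip g)"
      by (intro add_mono uniform_norm_upper)
    finally show ?thesis .
  qed
  then show "uniform_norm (Lip (\<lambda>x. f x + g x)) \<le> uniform_norm (Lip f) + uniform_norm (Lip g)"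
    by (subst uniform_norm_def, intro SUP_least)
qed

lemma D_inf_uminus: "f \<in> D_inf \<Longrightarrow> (\<lambda>x. - f x) \<in> D_inf"
  and D_inf_norm_uminus: "D_inf_norm (\<lambda>x. - f x) = D_inf_norm f"
  by (auto simp: D_inf_def D_inf_norm_def Lip_uminus uniform_norm_def)

lemma
  assumes "f \<in> D_inf" "g \<in> D_inf"
  shows D_inf_add: "(\<lambda>x. f x + g x) \<in> D_inf"
    and D_inf_norm_add: "D_inf_norm (\<lambda>x. f x + g x) \<le> D_inf_norm f + D_inf_norm g"
proof -
  let ?u = "\<lambda>f. uniform_norm (\<lambda>x. ereal (f x))" and ?v = "\<lambda>f. uniform_norm (Lip f)"
  obtain a b c d where r: "?u f = ereal a" "?u g = ereal b" "?v f = ereal c" "?v g = ereal d"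
    using D_infD(1,2)[OF assms(1)] D_infD(1,2)[OF assms(2)]
      uniform_norm_nonneg[of "Lip f"] uniform_norm_nonneg[of "Lip g"]
      uniform_norm_nonneg[of "\<lambda>x. ereal (f x)"] uniform_norm_nonneg[of "\<lambda>x. ereal (g x)"]
    by (cases "?u f"; cases "?u g"; cases "?v f"; cases "?v g") auto
  have le: "?u (\<lambda>x. f x + g x) \<le> ereal (a + b)" "?v (\<lambda>x. f x + g x) \<le> ereal (c + d)"
    using uniform_norm_add[OF assms] r by auto
  obtain p q where s: "?u (\<lambda>x. f x + g x) = ereal p" "?v (\<lambda>x. f x + g x) = ereal q"
    using le uniform_norm_nonneg[of "\<lambda>x. ereal (f x + g x)"] uniform_norm_nonneg[of "Lip (\<lambda>x. f x + g x)"]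
    by (cases "?u (\<lambda>x. f x + g x)"; cases "?v (\<lambda>x. f x + g x)") auto
  show "(\<lambda>x. f x + g x) \<in> D_inf" using s by (simp add: D_inf_def)
  show "D_inf_norm (\<lambda>x. f x + g x) \<le> D_inf_norm f + D_inf_norm g"
    using r s le by (simp add: D_inf_norm_def)
qed

lemma D_inf_norm_zero: "D_inf_norm f = 0 \<longleftrightarrow> (\<forall>x. f x = 0)" if f: "f \<in> D_inf"
proof -
  let ?u = "uniform_norm (\<lambda>x. ereal (f x))" and ?v = "uniform_norm (Lip f)"
  obtain a b where r: "?u = ereal a" "?v = ereal b"
    using D_infD(1,2)[OF f] uniform_norm_nonneg[of "Lip f"] uniform_norm_nonneg[of "\<lambda>x. ereal (f x)"]
    by (cases ?u; cases ?v) auto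
  have ab: "0 \<le> a" "0 \<le> b" and up: "\<bar>f x\<bar> \<le> a" for x
    using uniform_norm_nonneg[of "Lip f"] uniform_norm_nonneg[of "\<lambda>x. ereal (f x)"]
      uniform_norm_upper[of "\<lambda>x. ereal (f x)" x] r by auto
  show ?thesis
  proof
    assume "D_inf_norm f = 0"
    then have "a = 0" using ab r by (simp add: D_inf_norm_def)
    then show "\<forall>x. f x = 0" using up by auto
  next
    assume z: "\<forall>x. f x = 0"
    then have "Lip f x = 0" for x
      using D_infD(4)[OF f, of x] by (simp add: Lip_def Limsup_const zero_ereal_def[symmetric])
    with z show "D_inf_norm f = 0"
      by (simp add: D_inf_norm_def uniform_norm_def zero_ereal_def[symmetric])
  qed
qed

lemma D_inf_norm_nonneg: "0 \<le> D_inf_norm f"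
  unfolding D_inf_norm_def by (intro real_of_ereal_pos add_nonneg_nonneg uniform_norm_nonneg)

lemma Metric_space_D_inf: "Metric_space D_inf D_inf_dist"
proof
  fix f g h :: "'a \<Rightarrow> real"
  show "0 \<le> D_inf_dist f g" by (simp add: D_inf_dist_def D_inf_norm_nonneg)
  show "D_inf_dist f g = D_inf_dist g f"
    using D_inf_norm_uminus[of "\<lambda>x. f x - g x"] by (simp add: D_inf_dist_def)
  assume f: "f \<in> D_inf" and g: "g \<in> D_inf"
  have diff: "(\<lambda>x. u x - v x) \<in> D_inf" if "u \<in> D_inf" "v \<in> D_inf" for u v :: "'a \<Rightarrow> real"
    using D_inf_add[OF that(1) D_inf_uminus[OF that(2)]] by simp
  show "D_inf_dist f g = 0 \<longleftrightarrow> f = g"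
    using D_inf_norm_zero[OF diff[OF f g]] by (auto simp: D_inf_dist_def fun_eq_iff)
  assume h: "h \<in> D_inf"
  show "D_inf_dist f h \<le> D_inf_dist f g + D_inf_dist g h"
    using D_inf_norm_add[OF diff[OF f g] diff[OF g h]] by (simp add: D_inf_dist_def)
qed

end

theory Submission
  imports Defs
begin

text \<open>If some \<open>g\<close> in \<^const>\<open>D_inf\<close> has empty singular set, then for every \<open>f\<close> in \<^const>\<open>D_inf\<close> the
  sets \<open>S(f + t g)\<close>, for real \<open>t\<close>, are pairwise disjoint and Borel, so all but countably many of
  them are null; this gives density. Moreover the functions \<open>f\<close> for which \<open>Lip f\<close> is bounded
  away from 0 on a set of measure greater than \<open>1 - 1/n\<close> form an open set, and the intersection of
  these open sets consists of functions with null singular set. To obtain \<open>g\<close>, let \<open>\<rho>\<close> be the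
  intrinsic (path length) distance from a base point. It is Lipschitz by quasi-convexity,
  and moving from \<open>x\<close> towards the base point along an almost shortest path decreases \<open>\<rho>\<close> by
  almost at least the distance covered, so \<open>Lip \<rho> > 0\<close>. Then \<open>g = \<rho> / (1 + \<rho>)\<close> is also bounded.\<close>

section \<open>Intrinsic distance\<close>

lemma curve_length_ge_dist:
  assumes "a < b"
  shows "ereal (dist (\<gamma> a) (\<gamma> b)) \<le> curve_length a b \<gamma>"
  unfolding curve_length_def
  by (rule SUP_upper2[of "(1, \<lambda>i. if i = 1 then a else b)"]) (use assms in auto)

text \<open>Appending \<open>b\<close> to a partition of the interval from \<open>a\<close> to
  \<open>s\<close> gives a partition up to \<open>b\<close> whose sum is larger by exactly
  \<open>dist (\<gamma> s) (\<gamma> b)\<close>.\<close>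

lemma curve_length_initial_segment:
  assumes "s < b" and len: "curve_length a b \<gamma> \<le> ereal l"
  shows "curve_length a s \<gamma> \<le> ereal (l - dist (\<gamma> s) (\<gamma> b))"
  unfolding curve_length_def
proof (rule SUP_least, clarify)
  fix n :: nat and t :: "nat \<Rightarrow> real"
  assume t: "a = t 1" "s = t (n + 1)" "\<forall>i\<in>{1..n}. t i < t (i + 1)"
  \<comment> \<open>The points \<open>t 1\<close>, ..., \<open>t (n + 1)\<close> describe
    \<open>n\<close> intervals, so the appended point has index \<open>n + 2\<close>.\<close>
  define t' where "t' i = (if i = n + 2 then b else t i)" for i
  have "ereal (\<Sum>i = 1..n+1. dist (\<gamma> (t' i)) (\<gamma> (t' (i + 1)))) \<le> curve_length a b \<gamma>"
    unfolding curve_length_def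
    by (rule SUP_upper2[of "(n + 1, t')"]) (use t \<open>s < b\<close> in \<open>auto simp: t'_def\<close>)
  also have "(\<Sum>i = 1..n+1. dist (\<gamma> (t' i)) (\<gamma> (t' (i + 1)))) =
      (\<Sum>i = 1..n. dist (\<gamma> (t i)) (\<gamma> (t (i + 1)))) + dist (\<gamma> s) (\<gamma> b)"
    using t by (auto simp: t'_def intro!: sum.cong)
  finally have "ereal ((\<Sum>i = 1..n. dist (\<gamma> (t i)) (\<gamma> (t (i + 1)))) + dist (\<gamma> s) (\<gamma> b)) \<le> ereal l"
    using len by (rule order_trans)
  then show "ereal (\<Sum>i = 1..n. dist (\<gamma> (t i)) (\<gamma> (t (i + 1)))) \<le> ereal (l - dist (\<gamma> (t (n + 1))) (\<gamma> b))"
    using t by simp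
qed

text \<open>Working with chains of curves makes the triangle inequality for the intrinsic distance
  immediate, with no need for the additivity of \<^const>\<open>curve_length\<close> under concatenation.\<close>

inductive reachable_within :: "'a::metric_space \<Rightarrow> 'a \<Rightarrow> real \<Rightarrow> bool" for p where
  base: "reachable_within p p 0"
| extend: "reachable_within p (\<gamma> a) L \<Longrightarrow> a < b \<Longrightarrow> continuous_on {a..b} \<gamma> \<Longrightarrow>
    curve_length a b \<gamma> \<le> ereal l \<Longrightarrow> reachable_within p (\<gamma> b) (L + l)"

lemma reachable_within_dist_le: "reachable_within p x L \<Longrightarrow> dist p x \<le> L"
proof (induction rule: reachable_within.induct)
  case (extend \<gamma> a L b l)
  have "dist (\<gamma> a) (\<gamma> b) \<le> l"
    using curve_length_ge_dist[OF extend(2), of \<gamma>] extend(4) order_trans ereal_less_eq(3) by blast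
  then show ?case
    using extend.IH dist_triangle[of p "\<gamma> b" "\<gamma> a"] by linarith
qed simp

text \<open>Going back along the chain, look for the last curve that starts outside the closed ball
  of radius \<open>r\<close> about \<open>z\<close>. By the intermediate value theorem it crosses
  the sphere at some \<open>y\<close>; cutting the chain at \<open>y\<close> saves at least
  \<open>dist y x\<close>. The centre \<open>z\<close> is separate from \<open>x\<close> because the
  induction moves \<open>x\<close> while the sphere stays fixed. The application has
  \<open>z = x\<close>.\<close>

lemma reachable_within_meets_sphere:
  assumes "reachable_within p x L" "dist x z \<le> r" "r \<le> dist p z"
  shows "\<exists>y L'. dist y z = r \<and> reachable_within p y L' \<and> L' + dist y x \<le> L"
  using assms
proof (induction rule: reachable_within.induct)
  case base
  then show ?case
    by (intro exI[of _ p] exI[of _ 0]) (auto intro: reachable_within.base)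
next
  case (extend \<gamma> a L b l)
  have l: "dist (\<gamma> a) (\<gamma> b) \<le> l"
    using curve_length_ge_dist[OF extend(2), of \<gamma>] extend(4) order_trans ereal_less_eq(3) by blast
  show ?case
  proof (cases "dist (\<gamma> a) z \<le> r")
    case True
    then obtain y L' where "dist y z = r" "reachable_within p y L'" "L' + dist y (\<gamma> a) \<le> L"
      using extend by blast
    then show ?thesis
      using l dist_triangle[of y "\<gamma> b" "\<gamma> a"] by (intro exI[of _ y] exI[of _ L']) auto
  next
    case False
    have "continuous_on {a..b} (\<lambda>s. dist (\<gamma> s) z)"
      using extend by (intro continuous_intros)
    then obtain s where s: "a \<le> s" "s \<le> b" "dist (\<gamma> s) z = r"
      using IVT2'[of "\<lambda>s. dist (\<gamma> s) z" b r a] False extend by auto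
    then have "a < s" using False by (cases "a = s") auto
    show ?thesis
    \<comment> \<open>Truncating a curve requires \<open>s < b\<close>; if \<open>s = b\<close>, the
      whole chain already ends on the sphere.\<close>
    proof (cases "s = b")
      case True
      then show ?thesis
        using s extend(1-4) reachable_within.extend[of p \<gamma> a L b l]
        by (intro exI[of _ "\<gamma> b"] exI[of _ "L + l"]) auto
    next
      case False
      then have "curve_length a s \<gamma> \<le> ereal (l - dist (\<gamma> s) (\<gamma> b))"
        using s extend(4) by (intro curve_length_initial_segment) auto
      then have "reachable_within p (\<gamma> s) (L + (l - dist (\<gamma> s) (\<gamma> b)))"
        using \<open>a < s\<close> s extend(1,3) continuous_on_subset[OF extend(3), of "{a..s}"]
        by (intro reachable_within.extend[of p \<gamma> a]) auto
      then show ?thesis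
        using s by (intro exI[of _ "\<gamma> s"] exI) auto
    qed
  qed
qed

text \<open>The set is bounded below by \<open>dist p x\<close>. It may be empty in a general space,
  where the value is arbitrary; quasi-convexity makes it nonempty.\<close>

definition intrinsic_dist :: "'a::metric_space \<Rightarrow> 'a \<Rightarrow> real" where
  "intrinsic_dist p x = Inf {L. reachable_within p x L}"

lemma intrinsic_dist_le: "reachable_within p x L \<Longrightarrow> intrinsic_dist p x \<le> L"
  unfolding intrinsic_dist_def
  by (rule cInf_lower) (auto intro!: bdd_belowI dest: reachable_within_dist_le)

text \<open>The parameter \<open>type_of_space\<close> only ties the type of the space to the
  locale, so that an interpretation can supply it as \<open>TYPE('a)\<close>.\<close>

locale quasi_convex_space =
  fixes C :: real and type_of_space :: "'a::metric_space itself"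
  assumes curve_ex: "\<And>x y :: 'a. \<exists>a b \<gamma>. a < b \<and> continuous_on {a..b} \<gamma> \<and> \<gamma> a = x \<and> \<gamma> b = y \<and>
    curve_length a b \<gamma> \<le> ereal (C * dist x y)"
begin

lemma reachable_within_add:
  fixes x y :: 'a
  assumes "reachable_within p x L"
  shows "reachable_within p y (L + C * dist x y)"
  using curve_ex[of x y] assms reachable_within.extend by metis

lemma intrinsic_dist_approx:
  fixes p x :: 'a
  assumes "e > 0"
  obtains L where "reachable_within p x L" "L < intrinsic_dist p x + e"
proof -
  have "{L. reachable_within p x L} \<noteq> {}"
    using reachable_within_add[OF reachable_within.base] by auto
  then show thesis
    using cInf_lessD[of "{L. reachable_within p x L}" "intrinsic_dist p x + e"] assms that
    unfolding intrinsic_dist_def by auto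
qed

lemma intrinsic_dist_ge_dist: "dist p x \<le> intrinsic_dist p (x :: 'a)"
proof (rule field_le_epsilon)
  fix e :: real assume "0 < e"
  then obtain L where "reachable_within p x L" "L < intrinsic_dist p x + e"
    by (rule intrinsic_dist_approx)
  then show "dist p x \<le> intrinsic_dist p x + e"
    using reachable_within_dist_le by force
qed

lemma intrinsic_dist_self [simp]: "intrinsic_dist p (p :: 'a) = 0"
  using intrinsic_dist_le[OF reachable_within.base[of p]] intrinsic_dist_ge_dist[of p p]
  by simp

lemma intrinsic_dist_triangle:
  "intrinsic_dist p y \<le> intrinsic_dist p x + C * dist x (y :: 'a)"
proof (rule field_le_epsilon)
  fix e :: real assume "0 < e"
  then obtain L where "reachable_within p x L" "L < intrinsic_dist p x + e"
    by (rule intrinsic_dist_approx)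
  then show "intrinsic_dist p y \<le> intrinsic_dist p x + C * dist x y + e"
    using intrinsic_dist_le[OF reachable_within_add, of p x L y] by simp
qed

lemma intrinsic_dist_lipschitz:
  "\<bar>intrinsic_dist p x - intrinsic_dist p y\<bar> \<le> C * dist x (y :: 'a)"
  using intrinsic_dist_triangle[of p x y] intrinsic_dist_triangle[of p y x]
  by (simp add: abs_le_iff dist_commute)

text \<open>At the base point any nearby \<open>y\<close> works, since the intrinsic distance
  dominates \<open>dist\<close>. Elsewhere an almost shortest chain is cut where it meets a small
  sphere about \<open>x\<close>.\<close>

lemma intrinsic_dist_slope:
  fixes p x :: 'a
  assumes nb: "at x \<noteq> bot" and "r > 0"
  obtains y where "y \<noteq> x" "dist x y < r" "dist x y / 2 \<le> \<bar>intrinsic_dist p x - intrinsic_dist p y\<bar>"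
proof (cases "x = p")
  case True
  obtain y where "y \<noteq> x" "dist y x < r"
    using nb \<open>r > 0\<close> by (auto simp: trivial_limit_at islimpt_approachable trivial_limit_within)
  then show thesis
    using that[of y] intrinsic_dist_ge_dist[of p y] True by (simp add: dist_commute)
next
  case False
  \<comment> \<open>With this radius \<open>p\<close> is not strictly inside the sphere about
    \<open>x\<close>, so the chain from \<open>p\<close> must meet it, and every point of it is
    closer to \<open>x\<close> than \<open>r\<close>.\<close>
  define s where "s = min (r / 2) (dist p x)"
  have s: "0 < s" "s < r" "s \<le> dist p x"
    using False \<open>r > 0\<close> by (auto simp: s_def)
  \<comment> \<open>Cutting saves \<open>s\<close>, the excess length costs less than
    \<open>s / 2\<close>, and a net decrease of \<open>s / 2\<close> remains.\<close>
  obtain L where L: "reachable_within p x L" "L < intrinsic_dist p x + s / 2"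
    using intrinsic_dist_approx s by (metis half_gt_zero)
  obtain y L' where y: "dist y x = s" "reachable_within p y L'" "L' + dist y x \<le> L"
    using reachable_within_meets_sphere[OF L(1), of x s] s by auto
  have "intrinsic_dist p y \<le> intrinsic_dist p x - s / 2"
    using intrinsic_dist_le[OF y(2)] y L by linarith
  then show thesis
    using that[of y] y s by (auto simp: dist_commute)
qed

end

section \<open>The pointwise Lipschitz constant\<close>

text \<open>A limit superior below \<open>c\<close> would force every quotient close to
  \<open>x\<close> below \<open>c\<close>. The cap \<open>r0\<close> lets callers consider small
  radii only.\<close>

lemma Lip_ge_of_arbitrarily_close:
  assumes "\<And>r. 0 < r \<Longrightarrow> r \<le> r0 \<Longrightarrow> \<exists>y. y \<noteq> x \<and> dist x y < r \<and> c * dist x y \<le> \<bar>f x - f y\<bar>" "0 < r0"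
  shows "ereal c \<le> Lip f x"
proof (rule ccontr)
  assume "\<not> ereal c \<le> Lip f x"
  then have "\<forall>\<^sub>F y in at x. ereal (\<bar>f x - f y\<bar> / dist x y) < ereal c"
    unfolding Lip_def by (intro Limsup_lessD) auto
  then obtain d where d: "d > 0" "\<And>y. y \<noteq> x \<Longrightarrow> dist y x < d \<Longrightarrow> \<bar>f x - f y\<bar> / dist x y < c"
    by (auto simp: eventually_at)
  obtain y where y: "y \<noteq> x" "dist x y < min d r0" "c * dist x y \<le> \<bar>f x - f y\<bar>"
    using assms(1)[of "min d r0"] d(1) assms(2) by auto
  then show False
    using d(2)[of y] by (auto simp: dist_commute pos_divide_less_eq)
qed

lemma Lip_le_of_lipschitz:
  assumes "\<And>y. \<bar>f x - f y\<bar> \<le> c * dist x y"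
  shows "Lip f x \<le> ereal c"
  unfolding Lip_def
proof (rule Limsup_bounded, unfold eventually_at, intro exI[of _ 1] conjI ballI impI)
  fix y assume "y \<noteq> x \<and> dist y x < 1"
  then have "0 < dist x y" by auto
  then show "ereal (\<bar>f x - f y\<bar> / dist x y) \<le> ereal c"
    using assms[of y] by (simp add: pos_divide_le_eq)
qed simp

text \<open>At an isolated point \<open>Lip\<close> is minus infinity, and the identity would fail
  there for \<open>c = 0\<close>.\<close>

lemma Lip_scale:
  assumes "at x \<noteq> bot"
  shows "Lip (\<lambda>x. c * f x) x = ereal \<bar>c\<bar> * Lip f x"
proof -
  have eq: "\<bar>c * f x - c * f y\<bar> / dist x y = \<bar>c\<bar> * (\<bar>f x - f y\<bar> / dist x y)" for y
    by (simp add: abs_mult flip: right_diff_distrib)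
  show ?thesis
    unfolding Lip_def eq
    using Limsup_ereal_mult_left[OF assms, of "\<bar>c\<bar>" "\<lambda>y. ereal (\<bar>f x - f y\<bar> / dist x y)"]
    by (simp only: times_ereal.simps abs_ge_zero simp_thms)
qed

section \<open>A bounded Lipschitz function without singular points\<close>

lemma (in quasi_convex_space) ex_D_inf_Lip_pos:
  assumes nb: "\<And>x :: 'a. at x \<noteq> bot" and C: "C \<ge> 0"
  obtains g :: "'a \<Rightarrow> real" where "g \<in> D_inf" "\<And>x. 0 < Lip g x"
proof -
  fix p :: 'a
  define \<rho> where "\<rho> = intrinsic_dist p"
  define g where "g x = \<rho> x / (1 + \<rho> x)" for x
  have \<rho>0: "0 \<le> \<rho> x" for x
    using intrinsic_dist_ge_dist[of p x] zero_le_dist[of p x] unfolding \<rho>_def by linarith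
  have diff: "\<bar>g x - g y\<bar> = \<bar>\<rho> x - \<rho> y\<bar> / ((1 + \<rho> x) * (1 + \<rho> y))" for x y
  proof -
    have "g x - g y = (\<rho> x - \<rho> y) / ((1 + \<rho> x) * (1 + \<rho> y))"
      using \<rho>0[of x] \<rho>0[of y] by (simp add: g_def divide_simps) (simp add: algebra_simps)
    then show ?thesis
      using \<rho>0[of x] \<rho>0[of y] by (simp add: abs_mult)
  qed
  have lip: "\<bar>g x - g y\<bar> \<le> C * dist x y" for x y
  proof -
    have "1 * 1 \<le> (1 + \<rho> x) * (1 + \<rho> y)"
      using \<rho>0[of x] \<rho>0[of y] by (intro mult_mono) auto
    then have "\<bar>g x - g y\<bar> \<le> \<bar>\<rho> x - \<rho> y\<bar> / 1"
      unfolding diff by (intro divide_left_mono) auto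
    then show ?thesis
      using intrinsic_dist_lipschitz[of p x y] unfolding \<rho>_def by simp
  qed
  have "0 < Lip g x" for x
  proof -
    \<comment> \<open>For \<open>dist x y < 1\<close> the Lipschitz bound gives
      \<open>\<rho> y \<le> \<rho> x + C\<close>, which bounds the denominator in
      \<open>diff\<close>; the factor 2 comes from \<open>intrinsic_dist_slope\<close>. The constant
      depends on \<open>x\<close>, but only pointwise positivity is claimed.\<close>
    define c where "c = 1 / (2 * ((1 + \<rho> x) * (1 + \<rho> x + C)))"
    have "0 < c" using \<rho>0[of x] C by (simp add: c_def)
    have "ereal c \<le> Lip g x"
    proof (rule Lip_ge_of_arbitrarily_close)
      fix r :: real assume r: "0 < r" "r \<le> 1"
      obtain y where y: "y \<noteq> x" "dist x y < r" "dist x y / 2 \<le> \<bar>\<rho> x - \<rho> y\<bar>"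
        using intrinsic_dist_slope[OF nb r(1)] unfolding \<rho>_def by metis
      have "C * dist x y \<le> C * 1" using y r C by (intro mult_left_mono) auto
      then have "\<rho> y \<le> \<rho> x + C"
        using intrinsic_dist_triangle[of p y x] unfolding \<rho>_def by simp
      then have "(1 + \<rho> x) * (1 + \<rho> y) \<le> (1 + \<rho> x) * (1 + \<rho> x + C)"
        using \<rho>0[of x] by (intro mult_left_mono) auto
      moreover have "0 < (1 + \<rho> x) * (1 + \<rho> y)"
        using \<rho>0[of x] \<rho>0[of y] by simp
      ultimately have "(dist x y / 2) / ((1 + \<rho> x) * (1 + \<rho> x + C)) \<le> \<bar>g x - g y\<bar>"
        unfolding diff using y by (intro frac_le) auto
      then have "c * dist x y \<le> \<bar>g x - g y\<bar>" by (simp add: c_def)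
      then show "\<exists>y. y \<noteq> x \<and> dist x y < r \<and> c * dist x y \<le> \<bar>g x - g y\<bar>"
        using y by blast
    qed simp
    then show ?thesis
      using \<open>0 < c\<close> by (metis ereal_less(2) less_le_trans)
  qed
  moreover have "g \<in> D_inf"
  proof -
    have "uniform_norm (\<lambda>x. ereal (g x)) \<le> ereal 1"
      unfolding uniform_norm_def
    proof (rule SUP_least)
      fix x
      show "\<bar>ereal (g x)\<bar> \<le> ereal 1"
        using \<rho>0[of x] by (simp add: g_def pos_divide_le_eq)
    qed
    moreover have "uniform_norm (Lip g) \<le> ereal C"
      unfolding uniform_norm_def
    proof (rule SUP_least)
      fix x
      show "\<bar>Lip g x\<bar> \<le> ereal C"
        using Lip_le_of_lipschitz[OF lip] \<open>0 < Lip g x\<close> by simp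
    qed
    ultimately show ?thesis
      unfolding D_inf_def using add_mono by fastforce
  qed
  ultimately show thesis using that by blast
qed

section \<open>Linear structure of \<open>D_inf\<close> and continuity of its members\<close>

lemma D_inf_scale:
  assumes f: "f \<in> D_inf"
  shows "(\<lambda>x. c * f x) \<in> D_inf" "D_inf_norm (\<lambda>x. c * f x) = \<bar>c\<bar> * D_inf_norm f"
proof -
  let ?u = "\<lambda>f. uniform_norm (\<lambda>x. ereal (f x))"
  have scale: "uniform_norm (\<lambda>x. ereal \<bar>c\<bar> * h x) = ereal \<bar>c\<bar> * uniform_norm h" for h :: "'a \<Rightarrow> ereal"
    unfolding uniform_norm_def by (subst SUP_ereal_mult_left[symmetric]) (auto simp: ereal_abs_mult)
  have "Lip (\<lambda>x. c * f x) = (\<lambda>x. ereal \<bar>c\<bar> * Lip f x)"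
    using Lip_scale[OF D_infD(4)[OF f]] by auto
  then have v: "uniform_norm (Lip (\<lambda>x. c * f x)) = ereal \<bar>c\<bar> * uniform_norm (Lip f)"
    by (simp only: scale)
  have "?u (\<lambda>x. c * f x) = uniform_norm (\<lambda>x. ereal \<bar>c\<bar> * ereal (f x))"
    by (simp add: uniform_norm_def abs_mult)
  then have u: "?u (\<lambda>x. c * f x) = ereal \<bar>c\<bar> * ?u f"
    by (simp only: scale)
  obtain a b where r: "?u f = ereal a" "uniform_norm (Lip f) = ereal b"
    using D_infD(1,2)[OF f] uniform_norm_nonneg[of "Lip f"] uniform_norm_nonneg[of "\<lambda>x. ereal (f x)"]
    by (cases "?u f"; cases "uniform_norm (Lip f)") auto
  show "(\<lambda>x. c * f x) \<in> D_inf" "D_inf_norm (\<lambda>x. c * f x) = \<bar>c\<bar> * D_inf_norm f"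
    using u v r by (auto simp: D_inf_def D_inf_norm_def algebra_simps)
qed

lemma D_inf_diff: "f \<in> D_inf \<Longrightarrow> g \<in> D_inf \<Longrightarrow> (\<lambda>x. f x - g x) \<in> D_inf"
  using D_inf_add[OF _ D_inf_uminus] by fastforce

text \<open>This turns closeness in norm into control of \<open>Lip\<close> at every point, which
  gives the openness of the sets \<open>U n\<close> below.\<close>

lemma Lip_le_D_inf_norm:
  assumes f: "f \<in> D_inf"
  shows "Lip f x \<le> ereal (D_inf_norm f)"
proof -
  let ?u = "uniform_norm (\<lambda>x. ereal (f x))" and ?v = "uniform_norm (Lip f)"
  obtain a b where r: "?u = ereal a" "?v = ereal b"
    using D_infD(1,2)[OF f] uniform_norm_nonneg[of "Lip f"] uniform_norm_nonneg[of "\<lambda>x. ereal (f x)"]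
    by (cases ?u; cases ?v) auto
  have "Lip f x = \<bar>Lip f x\<bar>" using D_infD(5)[OF f] by simp
  also have "\<dots> \<le> ?v" by (rule uniform_norm_upper)
  finally show ?thesis
    using r uniform_norm_nonneg[of "\<lambda>x. ereal (f x)"] by (simp add: D_inf_norm_def order_trans)
qed

lemma Lip_diff_le:
  assumes "f \<in> D_inf" "g \<in> D_inf"
  shows "Lip (\<lambda>x. f x - g x) x \<le> Lip f x + Lip g x"
  using Lip_add[of x f "\<lambda>x. - g x"] D_infD(3-5)[OF assms(1), of x] D_infD(3)[OF assms(2), of x]
  by (auto simp: Lip_uminus)

text \<open>As \<open>Lip f x\<close> is finite, some real \<open>c\<close> bounds the quotients
  near \<open>x\<close>, so the increments of \<open>f\<close> at \<open>x\<close> are at most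
  \<open>c\<close> times the distance.\<close>

lemma D_inf_isCont:
  assumes "f \<in> D_inf"
  shows "isCont f x"
proof -
  obtain c where c: "Lip f x < ereal c"
    using ereal_dense2[of "Lip f x" \<infinity>] D_infD(3)[OF assms, of x] by auto
  then have "\<forall>\<^sub>F y in at x. ereal (\<bar>f x - f y\<bar> / dist x y) < ereal c"
    unfolding Lip_def by (intro Limsup_lessD)
  then have "\<forall>\<^sub>F y in at x. norm (f y - f x) \<le> dist y x * c"
    unfolding eventually_at
  proof (elim exE conjE, intro exI conjI ballI impI)
    fix d y assume "\<forall>y\<in>UNIV. y \<noteq> x \<and> dist y x < d \<longrightarrow> ereal (\<bar>f x - f y\<bar> / dist x y) < ereal c"
      "y \<noteq> x \<and> dist y x < d"
    then have "\<bar>f x - f y\<bar> / dist x y < c" "0 < dist x y" by auto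
    then have "\<bar>f x - f y\<bar> < c * dist x y" by (simp add: pos_divide_less_eq)
    then show "norm (f y - f x) \<le> dist y x * c"
      by (simp add: abs_minus_commute dist_commute mult.commute)
  qed
  moreover have "((\<lambda>y. dist y x * c) \<longlongrightarrow> 0) (at x)"
    by (auto intro!: tendsto_eq_intros)
  ultimately have "((\<lambda>y. f y - f x) \<longlongrightarrow> 0) (at x)"
    by (rule Lim_null_comparison)
  then show ?thesis by (simp add: isCont_def LIM_zero_iff)
qed

section \<open>Measurability of the singular set\<close>

text \<open>A Borel substitute for a superlevel set of \<open>Lip f\<close>: on \<open>D_inf\<close>
  it lies between the sets where \<open>Lip f\<close> exceeds 1/(k+1) and where it is at least
  1/(k+1). The strict inequalities make each set in the intersection open when \<open>f\<close> is
  continuous.\<close>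

definition steep_set :: "('a::metric_space \<Rightarrow> real) \<Rightarrow> nat \<Rightarrow> 'a set" where
  "steep_set f k = (\<Inter>n. {x. \<exists>y. y \<noteq> x \<and> dist x y < 1 / real (Suc n) \<and>
     1 / real (Suc k) * dist x y < \<bar>f x - f y\<bar>})"

text \<open>For fixed \<open>y\<close> the conditions are open in \<open>x\<close>, and the union
  over all \<open>y\<close>, though uncountable, stays open. Hence the steep set is a countable
  intersection of open sets.\<close>

lemma steep_set_borel:
  assumes "f \<in> D_inf"
  shows "steep_set f k \<in> sets borel"
proof -
  have cont: "continuous_on UNIV f"
    using D_inf_isCont[OF assms] by (simp add: continuous_at_imp_continuous_on)
  have "open {x. \<exists>y. y \<noteq> x \<and> dist x y < r \<and> c * dist x y < \<bar>f x - f y\<bar>}" for r c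
  proof -
    have "{x. \<exists>y. y \<noteq> x \<and> dist x y < r \<and> c * dist x y < \<bar>f x - f y\<bar>}
        = (\<Union>y. {x. y \<noteq> x} \<inter> {x. dist x y < r} \<inter> {x. c * dist x y < \<bar>f x - f y\<bar>})" by fast
    moreover have "open {x. y \<noteq> x}" "open {x. dist x y < r}" "open {x. c * dist x y < \<bar>f x - f y\<bar>}" for y
      by (intro open_Collect_neq open_Collect_less continuous_intros cont)+
    ultimately show ?thesis by (simp add: open_UN open_Int)
  qed
  then show ?thesis
    unfolding steep_set_def by (intro sets.countable_INT) (blast intro: borel_open)+
qed

lemma Lip_ge_on_steep_set:
  assumes "x \<in> steep_set f k"
  shows "ereal (1 / real (Suc k)) \<le> Lip f x"
proof (rule Lip_ge_of_arbitrarily_close)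
  fix r :: real assume "0 < r" "r \<le> 1"
  then obtain n where "1 / real (Suc n) < r"
    using nat_approx_posE by blast
  moreover obtain y where "y \<noteq> x" "dist x y < 1 / real (Suc n)"
    "1 / real (Suc k) * dist x y < \<bar>f x - f y\<bar>"
    using assms unfolding steep_set_def by blast
  ultimately show "\<exists>y. y \<noteq> x \<and> dist x y < r \<and> 1 / real (Suc k) * dist x y \<le> \<bar>f x - f y\<bar>"
    by (intro exI[of _ y]) linarith
qed simp

lemma in_steep_set:
  assumes nb: "at x \<noteq> bot" and lt: "ereal (1 / real (Suc k)) < Lip f x"
  shows "x \<in> steep_set f k"
proof (rule ccontr)
  assume "x \<notin> steep_set f k"
  then obtain n where n: "\<And>y. y \<noteq> x \<Longrightarrow> dist x y < 1 / real (Suc n) \<Longrightarrow>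
      \<bar>f x - f y\<bar> \<le> 1 / real (Suc k) * dist x y"
    unfolding steep_set_def by (fastforce simp: not_less)
  have "Lip f x \<le> ereal (1 / real (Suc k))"
    unfolding Lip_def
  proof (rule Limsup_bounded, unfold eventually_at, intro exI[of _ "1 / real (Suc n)"] conjI ballI impI)
    fix y assume y: "y \<noteq> x \<and> dist y x < 1 / real (Suc n)"
    then have "\<bar>f x - f y\<bar> \<le> 1 / real (Suc k) * dist x y"
      by (intro n) (auto simp: dist_commute)
    moreover have "0 < dist x y" using y by auto
    ultimately show "ereal (\<bar>f x - f y\<bar> / dist x y) \<le> ereal (1 / real (Suc k))"
      by (simp add: pos_divide_le_eq del: of_nat_Suc)
  qed simp
  with lt show False by simp
qed

text \<open>On \<open>D_inf\<close> the value \<open>Lip f x\<close> is nonnegative, so it is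
  nonzero iff it exceeds some 1/(k+1); the two preceding inclusions then suffice.\<close>

lemma singular_set_eq:
  assumes f: "f \<in> D_inf"
  shows "singular_set f = - (\<Union>k. steep_set f k)"
proof -
  have "Lip f x \<noteq> 0 \<longleftrightarrow> (\<exists>k. x \<in> steep_set f k)" for x
  proof
    assume "Lip f x \<noteq> 0"
    then have "0 < Lip f x" using D_infD(5)[OF f, of x] by simp
    then obtain k where "ereal (1 / real (Suc k)) < Lip f x"
      using nat_approx_posE by (cases "Lip f x") auto
    then show "\<exists>k. x \<in> steep_set f k"
      using in_steep_set D_infD(4)[OF f] by blast
  next
    assume "\<exists>k. x \<in> steep_set f k"
    then obtain k where "ereal (1 / real (Suc k)) \<le> Lip f x"
      using Lip_ge_on_steep_set by blast
    then show "Lip f x \<noteq> 0" by (auto simp: zero_ereal_def simp del: of_nat_Suc)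
  qed
  then show ?thesis unfolding singular_set_def by auto
qed

lemma singular_set_borel: "f \<in> D_inf \<Longrightarrow> singular_set f \<in> sets borel"
  by (subst singular_set_eq) (auto intro!: borel_comp steep_set_borel)

text \<open>A larger \<open>k\<close> demands less slope. Monotonicity prepares the use of
  continuity of the measure from below.\<close>

lemma incseq_steep_set: "incseq (steep_set f)"
proof (rule incseq_SucI)
  fix k
  have "1 / real (Suc (Suc k)) * dist x y < e" if "1 / real (Suc k) * dist x y < e" for x y :: 'a and e
    using that by (rule le_less_trans[rotated]) (intro mult_right_mono divide_left_mono; simp)
  then show "steep_set f k \<subseteq> steep_set f (Suc k)"
    unfolding steep_set_def by (intro INF_mono') blast
qed

text \<open>At a common singular point, subadditivity makes \<open>Lip\<close> of the difference
  \<open>(s - t) * g\<close> vanish, whereas it equals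
  \<open>\<bar>s - t\<bar> * Lip g x > 0\<close>.\<close>

lemma singular_sets_disjoint:
  assumes f: "f \<in> D_inf" and g: "g \<in> D_inf" and pos: "0 < Lip g x" and "s \<noteq> t"
  shows "x \<notin> singular_set (\<lambda>x. f x + s * g x) \<inter> singular_set (\<lambda>x. f x + t * g x)"
proof
  assume x: "x \<in> singular_set (\<lambda>x. f x + s * g x) \<inter> singular_set (\<lambda>x. f x + t * g x)"
  have "Lip (\<lambda>x. (s - t) * g x) x = Lip (\<lambda>x. (f x + s * g x) - (f x + t * g x)) x"
    by (simp add: algebra_simps)
  also have "\<dots> \<le> 0"
    using Lip_diff_le[OF D_inf_add[OF f D_inf_scale(1)[OF g]] D_inf_add[OF f D_inf_scale(1)[OF g]],
        of s t x] x
    by (simp add: singular_set_def)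
  finally have "ereal \<bar>s - t\<bar> * Lip g x \<le> 0"
    using Lip_scale[OF D_infD(4)[OF g]] by metis
  moreover have "0 < ereal \<bar>s - t\<bar> * Lip g x"
    using pos \<open>s \<noteq> t\<close> by (simp add: ereal_zero_less_0_iff)
  ultimately show False by simp
qed

text \<open>Finite partial sums are measures of disjoint unions, hence bounded by the total mass.
  The family is therefore summable, and a summable real family has countable support.\<close>

lemma (in finite_measure) countable_non_null_disjoint_family:
  assumes "disjoint_family_on A I" "\<And>i. i \<in> I \<Longrightarrow> A i \<in> sets M"
  shows "countable {i \<in> I. measure M (A i) \<noteq> 0}"
proof (rule summable_countable_real)
  show "(\<lambda>i. measure M (A i)) summable_on I"
  proof (rule nonneg_bdd_above_summable_on)
    show "bdd_above (sum (\<lambda>i. measure M (A i)) ` {F. F \<subseteq> I \<and> finite F})"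
    proof (rule bdd_aboveI2)
      fix F assume "F \<in> {F. F \<subseteq> I \<and> finite F}"
      then have F: "finite F" "A ` F \<subseteq> sets M" "disjoint_family_on A F"
        using assms disjoint_family_on_mono by auto
      show "(\<Sum>i\<in>F. measure M (A i)) \<le> measure M (space M)"
        using finite_measure_finite_Union[OF F] bounded_measure by metis
    qed
  qed simp
qed

section \<open>Residuality\<close>

theorem theorem1p1:
  fixes m :: "'a::polish_space measure"
  assumes "quasi_convex (UNIV :: 'a set)"
    and "prob_space m"
    and "sets m = sets borel"
  shows "residual_in D_inf_topology {f \<in> D_inf. singular_set f \<in> null_sets (completion m)}
       \<and> dense_in D_inf_topology {f \<in> D_inf. singular_set f \<in> null_sets (completion m)}"
proof -
  interpret m: prob_space m by fact
  interpret D: Metric_space "D_inf :: ('a \<Rightarrow> real) set" D_inf_dist by (rule Metric_space_D_inf)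
  have sp: "space m = UNIV" using sets_eq_imp_space_eq[OF assms(3)] by simp
  define A where "A = {f :: 'a \<Rightarrow> real. f \<in> D_inf \<and> singular_set f \<in> null_sets (completion m)}"
  \<comment> \<open>Measurability is carried by the witness \<open>K\<close>, which need not be a
    full superlevel set of \<open>Lip f\<close>; \<open>\<delta>\<close> and \<open>K\<close> may
    depend on \<open>f\<close>.\<close>
  define U where "U n = {f :: 'a \<Rightarrow> real. f \<in> D_inf \<and> (\<exists>\<delta>>0. \<exists>K\<in>sets m.
      1 - 1 / real (Suc n) < measure m K \<and> (\<forall>x\<in>K. ereal \<delta> \<le> Lip f x))}" for n
  have null_iff: "singular_set f \<in> null_sets (completion m) \<longleftrightarrow> measure m (singular_set f) = 0"
    if "f \<in> D_inf" for f :: "'a \<Rightarrow> real"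
  proof -
    have S: "singular_set f \<in> sets m" using singular_set_borel[OF that] assms(3) by simp
    then show ?thesis
      by (simp add: null_sets_completion_iff null_sets_def m.emeasure_eq_measure)
  qed

  \<comment> \<open>Density by perturbation\<close>
  have approx: "\<exists>h\<in>A. h \<in> D.mball f r" if f: "f \<in> D_inf" and "0 < r" for f :: "'a \<Rightarrow> real" and r :: real
  proof -
    obtain C where C: "C \<ge> 1" "\<forall>x y :: 'a. \<exists>a b \<gamma>. a < b \<and> continuous_on {a..b} \<gamma> \<and> \<gamma> a = x \<and>
        \<gamma> b = y \<and> curve_length a b \<gamma> \<le> ereal (C * dist x y)"
      using assms(1) unfolding quasi_convex_def by (elim exE conjE) (use UNIV_I in metis)
    interpret quasi_convex_space C "TYPE('a)" using C(2) by unfold_locales blast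
    \<comment> \<open>The mere existence of \<open>f\<close> in \<open>D_inf\<close> excludes
      isolated points. Over a one-point space \<open>D_inf\<close> is empty and the claim is
      vacuous.\<close>
    obtain g :: "'a \<Rightarrow> real" where g: "g \<in> D_inf" and pos: "\<And>x. 0 < Lip g x"
      using ex_D_inf_Lip_pos[OF D_infD(4)[OF f]] C(1) by auto
    let ?h = "\<lambda>t x. f x + t * g x"
    have h: "?h t \<in> D_inf" for t
      by (intro D_inf_add f D_inf_scale g)
    \<comment> \<open>Any \<open>t < d\<close> moves \<open>f\<close> by less than \<open>r\<close>
      in norm; the summand 1 keeps the denominator positive.\<close>
    define d where "d = r / (D_inf_norm g + 1)"
    have "0 < d" using \<open>0 < r\<close> D_inf_norm_nonneg[of g] by (simp add: d_def add_nonneg_pos)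
    have "countable {t \<in> {0<..<d}. measure m (singular_set (?h t)) \<noteq> 0}"
      using singular_sets_disjoint[OF f g pos] singular_set_borel[OF h] assms(3)
      by (intro m.countable_non_null_disjoint_family) (auto simp: disjoint_family_on_def)
    moreover have "uncountable {0<..<d}"
      using \<open>0 < d\<close> by (simp add: uncountable_open_interval)
    ultimately have "{0<..<d} \<noteq> {t \<in> {0<..<d}. measure m (singular_set (?h t)) \<noteq> 0}" by metis
    then obtain t where t: "0 < t" "t < d" "measure m (singular_set (?h t)) = 0" by auto
    have "D_inf_dist f (?h t) = t * D_inf_norm g"
      using D_inf_scale(2)[OF g, of "- t"] t(1) by (simp add: D_inf_dist_def)
    also have "\<dots> \<le> t * (D_inf_norm g + 1)" using t(1) by simp
    also have "\<dots> < d * (D_inf_norm g + 1)"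
      using t D_inf_norm_nonneg[of g] by (intro mult_strict_right_mono) auto
    also have "\<dots> = r" using D_inf_norm_nonneg[of g] by (simp add: d_def)
    finally have "?h t \<in> D.mball f r" using f h by simp
    moreover have "?h t \<in> A" using t(3) null_iff[OF h] h by (simp add: A_def)
    ultimately show "\<exists>h\<in>A. h \<in> D.mball f r" by blast
  qed
  then have dense_A: "D.mtopology closure_of A = D_inf"
    unfolding D.metric_closure_of by auto

  \<comment> \<open>If the singular set is null, the steep sets increase to a set of full measure,
    so one with large \<open>k\<close> serves as \<open>K\<close>, with 1/(k+1) as
    \<open>\<delta>\<close>.\<close>
  have A_sub: "A \<subseteq> U n" for n
  proof
    fix f assume "f \<in> A"
    then have f: "f \<in> D_inf" and S: "measure m (singular_set f) = 0"
      using null_iff by (auto simp: A_def)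
    have sets: "range (steep_set f) \<subseteq> sets m" using steep_set_borel[OF f] assms(3) by auto
    then have "measure m (\<Union>k. steep_set f k) = 1"
      using S m.prob_compl[of "\<Union>k. steep_set f k"] sp
      by (simp add: singular_set_eq[OF f] Compl_eq_Diff_UNIV sets.countable_UN)
    then have "(\<lambda>k. measure m (steep_set f k)) \<longlonglongrightarrow> 1"
      using m.finite_Lim_measure_incseq[OF sets incseq_steep_set] by simp
    then have "\<forall>\<^sub>F k in sequentially. 1 - 1 / real (Suc n) < measure m (steep_set f k)"
      by (rule order_tendstoD) simp
    then obtain k where k: "1 - 1 / real (Suc n) < measure m (steep_set f k)"
      by (auto simp: eventually_sequentially)
    then show "f \<in> U n"
      unfolding U_def using f sets Lip_ge_on_steep_set[of _ f k]
      by (auto intro!: exI[of _ "1 / real (Suc k)"] bexI[of _ "steep_set f k"] simp del: of_nat_Suc)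
  qed

  \<comment> \<open>A perturbation of norm below \<open>\<delta> / 2\<close> lowers
    \<open>Lip\<close> by at most \<open>\<delta> / 2\<close> at each point, so the same
    \<open>K\<close> works with \<open>\<delta> / 2\<close>.\<close>
  have open_U: "openin D.mtopology (U n)" for n
    unfolding D.openin_mtopology
  proof (intro conjI allI impI)
    show "U n \<subseteq> D_inf" by (auto simp: U_def)
    fix f assume "f \<in> U n"
    then obtain \<delta> K where f: "f \<in> D_inf" and \<delta>: "0 < \<delta>" and K: "K \<in> sets m"
      "1 - 1 / real (Suc n) < measure m K" "\<And>x. x \<in> K \<Longrightarrow> ereal \<delta> \<le> Lip f x"
      unfolding U_def by blast
    have "D.mball f (\<delta> / 2) \<subseteq> U n"
    proof
      fix g assume "g \<in> D.mball f (\<delta> / 2)"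
      then have g: "g \<in> D_inf" and fg: "D_inf_norm (\<lambda>x. f x - g x) < \<delta> / 2"
        by (auto simp: D_inf_dist_def)
      have "ereal (\<delta> / 2) \<le> Lip g x" if "x \<in> K" for x
      proof -
        have "ereal \<delta> \<le> Lip f x" by (rule K) fact
        also have "Lip f x \<le> Lip (\<lambda>x. f x - g x) x + Lip g x"
          using Lip_add[of x "\<lambda>x. f x - g x" g] D_infD(3,4)[OF D_inf_diff[OF f g], of x]
            D_infD(3)[OF g, of x] by auto
        also have "\<dots> \<le> ereal (\<delta> / 2) + Lip g x"
          using Lip_le_D_inf_norm[OF D_inf_diff[OF f g], of x] fg
          by (intro add_right_mono) (auto elim: order_trans)
        finally show ?thesis by (cases "Lip g x") auto
      qed
      then show "g \<in> U n"
        unfolding U_def using g \<delta> K(1,2) by (auto intro!: exI[of _ "\<delta> / 2"])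
    qed
    then show "\<exists>r>0. D.mball f r \<subseteq> U n" using \<delta> by (intro exI[of _ "\<delta> / 2"]) auto
  qed

  have dense_U: "D.mtopology closure_of U n = D_inf" for n
    using closure_of_mono[OF A_sub[of n], of D.mtopology] dense_A
      closure_of_subset_topspace[of D.mtopology "U n"] by auto

  have inter: "D_inf \<inter> (\<Inter>n. U n) \<subseteq> A"
  proof
    fix f :: "'a \<Rightarrow> real"
    assume *: "f \<in> D_inf \<inter> (\<Inter>n. U n)"
    then have f: "f \<in> D_inf" by simp
    \<comment> \<open>The witness \<open>K\<close> for \<open>U n\<close> misses the singular set
      because \<open>\<delta> > 0\<close>, and its complement has measure below 1/(n+1).\<close>
    have "measure m (singular_set f) < 1 / real (Suc n)" for n
    proof -
      have "f \<in> U n" using * by blast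
      then obtain \<delta> K where \<delta>: "0 < \<delta>" and K: "K \<in> sets m"
        "1 - 1 / real (Suc n) < measure m K" "\<And>x. x \<in> K \<Longrightarrow> ereal \<delta> \<le> Lip f x"
        unfolding U_def by blast
      have "singular_set f \<subseteq> space m - K"
        using K(3) \<delta> sp unfolding singular_set_def by fastforce
      then have "measure m (singular_set f) \<le> measure m (space m - K)"
        using K(1) by (intro m.finite_measure_mono) auto
      then show ?thesis using m.prob_compl[OF K(1)] K(2) by simp
    qed
    then have "\<not> 0 < measure m (singular_set f)"
      by (metis nat_approx_posE less_asym)
    then show "f \<in> A"
      using null_iff[OF f] f by (simp add: A_def zero_less_measure_iff)
  qed

  have "dense_in D.mtopology A"
    using dense_A by (auto simp: dense_in_def A_def)
  moreover have "residual_in D.mtopology A"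
    unfolding residual_in_def dense_in_def
    using open_U dense_U inter openin_subset[OF open_U]
    by (intro conjI exI[of _ "range U"]) (auto simp: A_def)
  ultimately show ?thesis
    unfolding A_def D_inf_topology_def by simp
qed

end
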